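(* Let KH denote the statement: for every integer $n>2$, $n$ does not divide $!n$. Then KH is equivalent to each one of the following six statements (that is, for each $i\in\{1,\dots,6\}$, KH holds if and only if statement $(i)$ holds): (1) For every odd prime $p$, in the field $\mathrm{GF}(p)$ one has $\displaystyle\sum_{k=0}^{p-1}(-1)^k (k+1)(k+2)\cdots(p-1)\neq 0$. (2) For every odd prime $p$, $\displaystyle\sum_{k=0}^{p-1}(-1)^k (k+1)(k+2)\cdots(p-1)\not\equiv 0 \pmod p$. (3) For every odd prime $p$, in $\mathrm{GF}(p)$ one has $\displaystyle\sum_{k=0}^{p-1}\binom{p-1}{k}(k+1)(k+2)\cdots(p-1)\neq 0$. (4) For every odd prime $p$, $\displaystyle\sum_{k=0}^{p-1}\binom{p-1}{k}(k+1)(k+2)\cdots(p-1)\not\equiv 0 \pmod p$. (5) For every odd prime $p$, in $\mathrm{GF}(p)$ one has $\displaystyle\sum_{k=0}^{p-1}\frac{(-1)^k}{k!}\neq 0$. (6) For every odd prime $p$, in $\mathrm{GF}(p)$ one has $\displaystyle\sum_{k=0}^{p-1}\frac{1}{k!}\binom{p-1}{k}\neq 0$.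
   Context: For a positive integer $n$, the left factorial is $!n=\sum_{i=0}^{n-1} i!$. $\mathrm{GF}(p)$ denotes the field with $p$ elements ($p$ prime); integers are interpreted in $\mathrm{GF}(p)$ via reduction mod $p$, and $1/k!$ is the inverse of $k!$ in $\mathrm{GF}(p)$ (which exists for $0\le k\le p-1$). For $k=p-1$ the product $(k+1)(k+2)\cdots(p-1)$ is the empty product $1$. *)

theory Defs
  imports "HOL-Number_Theory.Residues"
begin

definition left_factorial :: "nat \<Rightarrow> nat" where
  "left_factorial n = (\<Sum>i<n. fact i)"

definition KH :: bool where
  "KH \<longleftrightarrow> (\<forall>n::nat. n > 2 \<longrightarrow> \<not> n dvd left_factorial n)"

text \<open>Only meaningful as a field for prime \<open>p\<close>.\<close>

definition GF :: "nat \<Rightarrow> int ring" where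
  "GF p = residue_ring (int p)"

text \<open>Reduction of integers modulo \<open>p\<close>. The representatives \<open>0, \<dots>, p - 1\<close> are the carrier
  of \<open>GF p\<close>.\<close>

definition to_GF :: "nat \<Rightarrow> int \<Rightarrow> int" where
  "to_GF p a = a mod int p"

lemma field_GF: "prime p \<Longrightarrow> field (GF p)"
  unfolding GF_def
  by (rule residues_prime.is_field) (rule residues_prime.intro)

lemma card_carrier_GF: "card (carrier (GF p)) = p"
  by (simp add: GF_def residue_ring_def)

lemma to_GF_ring_hom:
  assumes "prime p"
  shows "to_GF p \<in> ring_hom \<lparr>carrier = UNIV, monoid.mult = (*), one = 1, zero = 0, add = (+)\<rparr> (GF p)"
  using prime_gt_1_nat[OF assms]
  by (auto simp: ring_hom_def to_GF_def GF_def residue_ring_def mod_simps)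

end

theory Submission
  imports Defs
begin

text \<open>
  Discarding the terms \<open>i!\<close> with \<open>i \<ge> p\<close> gives \<open>!n \<equiv> !p (mod p)\<close> whenever \<open>p\<close> divides \<open>n\<close>, so a
  counterexample to KH with an odd prime factor \<open>p\<close> makes \<open>p\<close> itself a counterexample, while a
  multiple of \<open>4\<close> is excluded by \<open>!n \<equiv> !4 \<equiv> 2 (mod 4)\<close>. For an odd prime \<open>p\<close> all six sums are
  \<open>\<plusminus>!p\<close> modulo \<open>p\<close>: one has \<open>(k+1)\<cdots>(p-1) \<equiv> (-1)\<^sup>k (p-1-k)!\<close>, the binomial coefficient
  \<open>binom(p-1,k)\<close> is \<open>\<equiv> (-1)\<^sup>k\<close>, and \<open>1/k! = -(k+1)\<cdots>(p-1)\<close> by Wilson's theorem.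
\<close>

text \<open>Every \<open>i!\<close> with \<open>i \<ge> m\<close> is a multiple of \<open>m\<close>.
  The modulus is arbitrary because the result is used both for an odd prime and for
  \<open>4\<close>.\<close>

lemma left_factorial_cong:
  assumes "0 < m" "m \<le> n"
  shows "[left_factorial n = left_factorial m] (mod m)"
proof -
  have "left_factorial n = left_factorial m + (\<Sum>i=m..<n. fact i)"
    unfolding left_factorial_def lessThan_atLeast0
    using sum.atLeastLessThan_concat[of 0 m n "fact :: nat \<Rightarrow> nat"] assms by simp
  moreover have "m dvd (\<Sum>i=m..<n. fact i)"
    using assms(1) by (intro dvd_sum dvd_fact) auto
  ultimately show ?thesis
    by (auto simp: cong_def)
qed

lemma KH_iff_odd_primes:
  "KH \<longleftrightarrow> (\<forall>p. prime p \<and> odd p \<longrightarrow> \<not> p dvd left_factorial p)"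
proof
  assume KH
  then show "\<forall>p. prime p \<and> odd p \<longrightarrow> \<not> p dvd left_factorial p"
    unfolding KH_def using prime_ge_2_nat by (metis le_neq_implies_less even_numeral)
next
  assume odd_primes: "\<forall>p. prime p \<and> odd p \<longrightarrow> \<not> p dvd left_factorial p"
  show KH
    unfolding KH_def
  proof (intro allI impI notI)
    fix n :: nat
    assume n: "n > 2" "n dvd left_factorial n"
    show False
    proof (cases "\<exists>p. prime p \<and> odd p \<and> p dvd n")
      case True
      then obtain p where p: "prime p" "odd p" "p dvd n" by blast
      have "0 < p" "p \<le> n"
        using p n(1) by (auto dest: dvd_imp_le intro: prime_gt_0_nat)
      with p n(2) have "p dvd left_factorial p"
        using left_factorial_cong cong_dvd_iff dvd_trans by metis
      with p odd_primes show False by blast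
    next
      case False
      then have two: "p = 2" if "prime p" "p dvd n" for p
        using that prime_odd_nat prime_ge_2_nat by (metis le_neq_implies_less)
      obtain p where "prime p" "p dvd n"
        using n(1) prime_factor_nat[of n] by auto
      with two obtain m where m: "n = 2 * m" by blast
      \<comment> \<open>Since \<open>n > 2\<close>, the cofactor \<open>m\<close> is not
        \<open>1\<close> and so has a prime factor itself, which must again be
        \<open>2\<close>.\<close>
      obtain q where q: "prime q" "q dvd m"
        using n(1) m prime_factor_nat[of m] by auto
      with two[of q] m have "2 dvd m" by auto
      with m have "4 dvd n" by auto
      then have "4 dvd left_factorial 4"
        using n left_factorial_cong[of 4 n] cong_dvd_iff[of _ _ 4] dvd_trans[of 4 n]
          dvd_imp_le[of 4 n] by auto
      moreover have "left_factorial 4 = 10"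
        by (simp add: left_factorial_def eval_nat_numeral)
      ultimately show False by simp
    qed
  qed
qed

text \<open>Each factor \<open>p - i\<close> is congruent to \<open>-i\<close>, so the top
  \<open>m\<close> factors below \<open>p\<close> contribute \<open>m\<close> signs and
  \<open>m!\<close>. Indexing by the number of factors lets the induction prepend one factor at the
  lower end.\<close>

lemma prod_top_cong:
  assumes "m < p"
  shows "[(\<Prod>j = p - m..p - 1. int j) = (-1) ^ m * fact m] (mod int p)"
  using assms
proof (induction m)
  case 0
  then show ?case by simp
next
  case (Suc m)
  have "(\<Prod>j = p - Suc m..p - 1. int j) = int (p - Suc m) * (\<Prod>j = p - m..p - 1. int j)"
    using Suc.prems prod.atLeast_Suc_atMost[of "p - Suc m" "p - 1" int]
    by (cases "m = 0") (auto simp: Suc_diff_Suc)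
  also have "[\<dots> = - int (Suc m) * ((-1) ^ m * fact m)] (mod int p)"
    using Suc by (intro cong_mult) (auto simp: cong_iff_dvd_diff of_nat_diff)
  also have "- int (Suc m) * ((-1) ^ m * fact m) = (-1) ^ Suc m * fact (Suc m)"
    by (simp add: algebra_simps)
  finally show ?case .
qed

text \<open>By Pascal's rule two neighbouring coefficients of row \<open>p - 1\<close> add up to an
  inner coefficient of row \<open>p\<close>, which \<open>p\<close> divides. Hence neighbours are
  negatives of each other, starting from \<open>1\<close>.\<close>

lemma binomial_prime_minus_one_cong:
  assumes "prime p" "k < p"
  shows "[int ((p - 1) choose k) = (-1) ^ k] (mod int p)"
  using assms(2)
proof (induction k)
  case 0
  then show ?case by simp
next
  case (Suc k)
  have "p choose Suc k = ((p - 1) choose k) + ((p - 1) choose Suc k)"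
    using Suc.prems binomial_Suc_Suc[of "p - 1" k] by simp
  moreover have "p dvd (p choose Suc k)"
    using Suc.prems assms(1) by (intro dvd_choose_prime) auto
  ultimately have "int p dvd int ((p - 1) choose Suc k) + int ((p - 1) choose k)"
    by (metis add.commute of_nat_add of_nat_dvd_iff)
  then have "[int ((p - 1) choose Suc k) = - int ((p - 1) choose k)] (mod int p)"
    by (simp add: cong_iff_dvd_diff)
  also have "[- int ((p - 1) choose k) = - ((-1) ^ k)] (mod int p)"
    using Suc by (simp add: cong_minus_minus_iff)
  finally show ?case by simp
qed

lemma alternating_sum_cong:
  assumes "odd p"
  shows "[(\<Sum>k = 0..p - 1. (-1) ^ k * (\<Prod>j = k + 1..p - 1. int j))
            = int (left_factorial p)] (mod int p)"
proof -
  have p: "p > 0" using assms by (rule odd_pos)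
  have "[(-1) ^ k * (\<Prod>j = k + 1..p - 1. int j) = fact (p - 1 - k)] (mod int p)"
    if "k \<in> {0..p - 1}" for k
  proof -
    \<comment> \<open>The product from \<open>k + 1\<close> to \<open>p - 1\<close> consists of the
      top \<open>p - 1 - k\<close> factors.\<close>
    have k: "p - (p - 1 - k) = k + 1" "p - 1 - k < p" using that p by auto
    have "[(-1) ^ k * (\<Prod>j = k + 1..p - 1. int j)
             = (-1) ^ k * ((-1) ^ (p - 1 - k) * fact (p - 1 - k))] (mod int p)"
      using prod_top_cong[OF k(2)] unfolding k(1) by (rule cong_scalar_left)
    \<comment> \<open>The signs combine to \<open>(-1) ^ (p - 1)\<close>, which is \<open>1\<close>
      because \<open>p\<close> is odd.\<close>
    also have "(-1) ^ k * ((-1) ^ (p - 1 - k) * fact (p - 1 - k)) = (-1) ^ (p - 1) * (fact (p - 1 - k) :: int)"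
      using that by (simp add: power_add[symmetric] mult.assoc[symmetric] del: diff_diff_left)
    finally show ?thesis using assms by simp
  qed
  then have "[(\<Sum>k = 0..p - 1. (-1) ^ k * (\<Prod>j = k + 1..p - 1. int j))
      = (\<Sum>k = 0..p - 1. fact (p - 1 - k))] (mod int p)"
    by (rule cong_sum)
  also have "(\<Sum>k = 0..p - 1. fact (p - 1 - k)) = (\<Sum>k = 0..p - 1. fact k :: int)"
    by (rule sum.reindex_bij_witness[of _ "\<lambda>k. p - 1 - k" "\<lambda>k. p - 1 - k"]) auto
  also have "\<dots> = int (left_factorial p)"
  proof -
    have "{0..p - 1} = {..<p}" using p by auto
    then show ?thesis by (simp add: left_factorial_def)
  qed
  finally show ?thesis .
qed

lemma binomial_sum_cong:
  assumes "prime p" "odd p"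
  shows "[(\<Sum>k = 0..p - 1. int ((p - 1) choose k) * (\<Prod>j = k + 1..p - 1. int j))
            = int (left_factorial p)] (mod int p)"
proof -
  have "[(\<Sum>k = 0..p - 1. int ((p - 1) choose k) * (\<Prod>j = k + 1..p - 1. int j))
      = (\<Sum>k = 0..p - 1. (-1) ^ k * (\<Prod>j = k + 1..p - 1. int j))] (mod int p)"
    using assms(1) prime_gt_0_nat[OF assms(1)]
    by (intro cong_sum cong_scalar_right binomial_prime_minus_one_cong) auto
  with alternating_sum_cong[OF assms(2)] show ?thesis by (rule cong_trans[rotated])
qed

text \<open>Reduction modulo \<open>p\<close> commutes with the ring operations. Read from left to
  right, these rules collect an expression in \<open>GF p\<close> into the image of one integer,
  whose vanishing is then a congruence.\<close>

lemma
  assumes "prime p"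
  shows to_GF_mult: "to_GF p a \<otimes>\<^bsub>GF p\<^esub> to_GF p b = to_GF p (a * b)"
    and to_GF_power: "to_GF p a [^]\<^bsub>GF p\<^esub> k = to_GF p (a ^ k)"
    and to_GF_uminus_one: "\<ominus>\<^bsub>GF p\<^esub> \<one>\<^bsub>GF p\<^esub> = to_GF p (-1)"
    and to_GF_sum: "finite A \<Longrightarrow> (\<Oplus>\<^bsub>GF p\<^esub>i\<in>A. to_GF p (f i)) = to_GF p (\<Sum>i\<in>A. f i)"
    and to_GF_prod: "finite A \<Longrightarrow> (\<Otimes>\<^bsub>GF p\<^esub>i\<in>A. to_GF p (f i)) = to_GF p (\<Prod>i\<in>A. f i)"
    and to_GF_eq_zero_iff: "to_GF p a = \<zero>\<^bsub>GF p\<^esub> \<longleftrightarrow> [a = 0] (mod int p)"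
proof -
  interpret residues_prime p "GF p"
    using assms by (simp_all add: residues_prime_def GF_def)
  show "to_GF p a \<otimes>\<^bsub>GF p\<^esub> to_GF p b = to_GF p (a * b)"
    by (simp add: to_GF_def mult_cong)
  show "to_GF p a [^]\<^bsub>GF p\<^esub> k = to_GF p (a ^ k)"
    by (simp add: to_GF_def pow_cong)
  show "\<ominus>\<^bsub>GF p\<^esub> \<one>\<^bsub>GF p\<^esub> = to_GF p (-1)"
    by (simp add: to_GF_def one_cong neg_cong)
  show "finite A \<Longrightarrow> (\<Oplus>\<^bsub>GF p\<^esub>i\<in>A. to_GF p (f i)) = to_GF p (\<Sum>i\<in>A. f i)"
    by (simp add: to_GF_def sum_cong)
  show "finite A \<Longrightarrow> (\<Otimes>\<^bsub>GF p\<^esub>i\<in>A. to_GF p (f i)) = to_GF p (\<Prod>i\<in>A. f i)"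
    by (simp add: to_GF_def prod_cong)
  show "to_GF p a = \<zero>\<^bsub>GF p\<^esub> \<longleftrightarrow> [a = 0] (mod int p)"
    by (simp add: to_GF_def res_zero_eq cong_def)
qed

text \<open>Multiplying \<open>k!\<close> by the remaining factors up to \<open>p - 1\<close> gives
  \<open>(p - 1)!\<close>, which is \<open>-1\<close> by Wilson's theorem. The negated product is
  therefore the inverse.\<close>

lemma inv_to_GF_fact:
  assumes "prime p" "k < p"
  shows "inv\<^bsub>GF p\<^esub> (to_GF p (fact k)) = to_GF p (- (\<Prod>j = k + 1..p - 1. int j))"
proof -
  interpret residues_prime p "GF p"
    using assms by (simp_all add: residues_prime_def GF_def)
  let ?P = "\<Prod>j = k + 1..p - 1. int j"
  have "fact k * ?P = fact (p - 1)"
  proof -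
    have "{1..p - 1} = {1..k} \<union> {k + 1..p - 1}" using assms(2) by auto
    then show ?thesis
      by (simp add: fact_prod prod.union_disjoint)
  qed
  moreover have "[fact (p - 1) = (-1 :: int)] (mod int p)"
    using wilson_theorem[OF assms(1)] .
  ultimately have "[fact k * - ?P = 1] (mod int p)"
    using cong_minus_minus_iff by fastforce
  then have "to_GF p (fact k) \<otimes>\<^bsub>GF p\<^esub> to_GF p (- ?P) = \<one>\<^bsub>GF p\<^esub>"
    unfolding to_GF_mult[OF assms(1)] by (simp only: to_GF_def cong_def one_cong)
  then show ?thesis
    by (intro comm_inv_char) (auto simp: to_GF_def)
qed

theorem theorem2p1:
  shows
   "(KH \<longleftrightarrow>
      (\<forall>p::nat. prime p \<and> odd p \<longrightarrow>
        (\<Oplus>\<^bsub>GF p\<^esub>k\<in>{0..p - 1}.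
            ((\<ominus>\<^bsub>GF p\<^esub> \<one>\<^bsub>GF p\<^esub>) [^]\<^bsub>GF p\<^esub> k)
              \<otimes>\<^bsub>GF p\<^esub> (\<Otimes>\<^bsub>GF p\<^esub>j\<in>{k + 1..p - 1}. to_GF p (int j)))
          \<noteq> \<zero>\<^bsub>GF p\<^esub>))
  \<and> (KH \<longleftrightarrow>
      (\<forall>p::nat. prime p \<and> odd p \<longrightarrow>
        \<not> [(\<Sum>k = 0..p - 1. (-1) ^ k * (\<Prod>j = k + 1..p - 1. int j)) = 0] (mod int p)))
  \<and> (KH \<longleftrightarrow>
      (\<forall>p::nat. prime p \<and> odd p \<longrightarrow>
        (\<Oplus>\<^bsub>GF p\<^esub>k\<in>{0..p - 1}.
            to_GF p (int ((p - 1) choose k))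
              \<otimes>\<^bsub>GF p\<^esub> (\<Otimes>\<^bsub>GF p\<^esub>j\<in>{k + 1..p - 1}. to_GF p (int j)))
          \<noteq> \<zero>\<^bsub>GF p\<^esub>))
  \<and> (KH \<longleftrightarrow>
      (\<forall>p::nat. prime p \<and> odd p \<longrightarrow>
        \<not> [(\<Sum>k = 0..p - 1. int ((p - 1) choose k) * (\<Prod>j = k + 1..p - 1. int j)) = 0] (mod int p)))
  \<and> (KH \<longleftrightarrow>
      (\<forall>p::nat. prime p \<and> odd p \<longrightarrow>
        (\<Oplus>\<^bsub>GF p\<^esub>k\<in>{0..p - 1}.
            ((\<ominus>\<^bsub>GF p\<^esub> \<one>\<^bsub>GF p\<^esub>) [^]\<^bsub>GF p\<^esub> k)
              \<otimes>\<^bsub>GF p\<^esub> (inv\<^bsub>GF p\<^esub> (to_GF p (fact k))))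
          \<noteq> \<zero>\<^bsub>GF p\<^esub>))
  \<and> (KH \<longleftrightarrow>
      (\<forall>p::nat. prime p \<and> odd p \<longrightarrow>
        (\<Oplus>\<^bsub>GF p\<^esub>k\<in>{0..p - 1}.
            (inv\<^bsub>GF p\<^esub> (to_GF p (fact k)))
              \<otimes>\<^bsub>GF p\<^esub> to_GF p (int ((p - 1) choose k)))
          \<noteq> \<zero>\<^bsub>GF p\<^esub>))"
proof -
  let ?P = "\<lambda>p k. \<Prod>j = k + 1..p - 1. int j"
  \<comment> \<open>These two integer sums govern all six statements: (1), (2) and (5) reduce to
    \<open>?A\<close>, the others to \<open>?B\<close>. Inverse factorials in (5) and (6) only add a
    global minus sign.\<close>
  let ?A = "\<lambda>p. \<Sum>k = 0..p - 1. (-1) ^ k * ?P p k"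
  let ?B = "\<lambda>p. \<Sum>k = 0..p - 1. int ((p - 1) choose k) * ?P p k"
  have A: "[?A p = 0] (mod int p) \<longleftrightarrow> p dvd left_factorial p" if "odd p" for p
    using cong_dvd_iff[OF alternating_sum_cong[OF that]] by (simp add: cong_0_iff)
  have B: "[?B p = 0] (mod int p) \<longleftrightarrow> p dvd left_factorial p" if "prime p" "odd p" for p
    using cong_dvd_iff[OF binomial_sum_cong[OF that]] by (simp add: cong_0_iff)
  note hom = to_GF_mult to_GF_power to_GF_uminus_one to_GF_sum to_GF_prod
  have sum1: "(\<Oplus>\<^bsub>GF p\<^esub>k\<in>{0..p - 1}. ((\<ominus>\<^bsub>GF p\<^esub> \<one>\<^bsub>GF p\<^esub>) [^]\<^bsub>GF p\<^esub> k)
      \<otimes>\<^bsub>GF p\<^esub> (\<Otimes>\<^bsub>GF p\<^esub>j\<in>{k + 1..p - 1}. to_GF p (int j))) = to_GF p (?A p)"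
    if "prime p" for p
    using that by (simp add: hom)
  have sum3: "(\<Oplus>\<^bsub>GF p\<^esub>k\<in>{0..p - 1}. to_GF p (int ((p - 1) choose k))
      \<otimes>\<^bsub>GF p\<^esub> (\<Otimes>\<^bsub>GF p\<^esub>j\<in>{k + 1..p - 1}. to_GF p (int j))) = to_GF p (?B p)"
    if "prime p" for p
    using that by (simp add: hom)
  have inv: "inv\<^bsub>GF p\<^esub> (to_GF p (fact k)) = to_GF p (- ?P p k)"
    if "prime p" "k \<in> {0..p - 1}" for p k
    using that prime_gt_0_nat[of p] by (intro inv_to_GF_fact) auto
  have sum5: "(\<Oplus>\<^bsub>GF p\<^esub>k\<in>{0..p - 1}. ((\<ominus>\<^bsub>GF p\<^esub> \<one>\<^bsub>GF p\<^esub>) [^]\<^bsub>GF p\<^esub> k)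
      \<otimes>\<^bsub>GF p\<^esub> (inv\<^bsub>GF p\<^esub> (to_GF p (fact k)))) = to_GF p (- ?A p)"
    if "prime p" for p
  proof -
    interpret residues_prime p "GF p"
      using that by (simp_all add: residues_prime_def GF_def)
    \<comment> \<open>The formula for the inverse holds only for \<open>k\<close> in the index
      range, so the summands are replaced under a congruence rule, which also asks that they lie in
      the carrier.\<close>
    have "(\<Oplus>\<^bsub>GF p\<^esub>k\<in>{0..p - 1}. ((\<ominus>\<^bsub>GF p\<^esub> \<one>\<^bsub>GF p\<^esub>) [^]\<^bsub>GF p\<^esub> k)
        \<otimes>\<^bsub>GF p\<^esub> (inv\<^bsub>GF p\<^esub> (to_GF p (fact k))))
      = (\<Oplus>\<^bsub>GF p\<^esub>k\<in>{0..p - 1}. to_GF p ((-1) ^ k * - ?P p k))"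
      using that inv by (intro finsum_cong') (simp_all add: hom, simp_all add: to_GF_def)
    then show ?thesis using that by (simp add: hom sum_negf)
  qed
  have sum6: "(\<Oplus>\<^bsub>GF p\<^esub>k\<in>{0..p - 1}. (inv\<^bsub>GF p\<^esub> (to_GF p (fact k)))
      \<otimes>\<^bsub>GF p\<^esub> to_GF p (int ((p - 1) choose k))) = to_GF p (- ?B p)"
    if "prime p" for p
  proof -
    interpret residues_prime p "GF p"
      using that by (simp_all add: residues_prime_def GF_def)
    have "(\<Oplus>\<^bsub>GF p\<^esub>k\<in>{0..p - 1}. (inv\<^bsub>GF p\<^esub> (to_GF p (fact k)))
        \<otimes>\<^bsub>GF p\<^esub> to_GF p (int ((p - 1) choose k)))
      = (\<Oplus>\<^bsub>GF p\<^esub>k\<in>{0..p - 1}. to_GF p (- ?P p k * int ((p - 1) choose k)))"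
      using that inv by (intro finsum_cong') (simp_all add: hom, simp_all add: to_GF_def)
    then show ?thesis using that by (simp add: hom sum_negf mult.commute)
  qed
  have neg: "[- a = 0] (mod m) \<longleftrightarrow> [a = 0] (mod m)" for a m :: int
    by (simp add: cong_0_iff)
  have KH_A: "KH \<longleftrightarrow> (\<forall>p. prime p \<and> odd p \<longrightarrow> \<not> [?A p = 0] (mod int p))"
    using A by (auto simp only: KH_iff_odd_primes)
  have KH_B: "KH \<longleftrightarrow> (\<forall>p. prime p \<and> odd p \<longrightarrow> \<not> [?B p = 0] (mod int p))"
    using B by (auto simp only: KH_iff_odd_primes)
  \<comment> \<open>The sign of the integer sum does not affect whether it vanishes. With
    \<open>S\<close> and \<open>a\<close> left abstract, this covers all four statements in
    \<open>GF p\<close>.\<close>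
  have GF_iff: "KH \<longleftrightarrow> (\<forall>p. prime p \<and> odd p \<longrightarrow> S p \<noteq> \<zero>\<^bsub>GF p\<^esub>)"
    if "KH \<longleftrightarrow> (\<forall>p. prime p \<and> odd p \<longrightarrow> \<not> [a p = 0] (mod int p))"
      and "\<And>p. prime p \<Longrightarrow> S p = to_GF p (a p) \<or> S p = to_GF p (- a p)"
    for a S :: "nat \<Rightarrow> int"
    unfolding that(1) using that(2) to_GF_eq_zero_iff neg by metis
  show ?thesis
    by (intro conjI GF_iff[OF KH_A] GF_iff[OF KH_B] KH_A KH_B disjI1[OF sum1] disjI1[OF sum3]
        disjI2[OF sum5] disjI2[OF sum6])
qed

end
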